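(* Let $p>0$, $\nu\ge0$, and let $\kappa,\mu\in\mathbb{C}$ with $2\mu\notin\{-1,-2,\ldots\}$ and $\mu\pm\kappa+\frac12\notin\{0,-1,-2,\ldots\}$. Then, as $x\to+\infty$ through positive real values, the leading asymptotic behaviour of $M_{\kappa,\mu}^{(p,\nu)}(x)$ is independent of $\nu$ and is given by $$M_{\kappa,\mu}^{(p,\nu)}(x)\sim A\,x^{(\mu-\kappa)/2}\exp\left(\tfrac12x-2\sqrt{px}\right)\qquad(x\to+\infty),$$ where $$A=\frac{\sqrt{\pi}\,e^{-p}\,p^{(\mu+\kappa)/2}}{B(\mu-\kappa+\frac12,\mu+\kappa+\frac12)}.$$ Here $f\sim g$ means $f(x)/g(x)\to1$.
   Context: $B(x,y)=\Gamma(x)\Gamma(y)/\Gamma(x+y)$ is the Beta function ($x,y\ne 0,-1,-2,\ldots$), and $K_\lambda$ is the modified Bessel function of the second kind. For $\Re(p)>0$, $\nu\ge 0$, the extended Beta function is $$B_{p,\nu}(x,y)=\sqrt{\frac{2p}{\pi}}\int_0^1 t^{x-\frac32}(1-t)^{y-\frac32}K_{\nu+\frac12}\left(\frac{p}{t(1-t)}\right)dt.$$ The $(p,\nu)$-extended confluent hypergeometric function is $$\Phi_{p,\nu}(b;c;z)=\sum_{m=0}^\infty\frac{B_{p,\nu}(b+m,c-b)}{B(b,c-b)}\frac{z^m}{m!}=\frac{1}{B(b,c-b)}\sqrt{\frac{2p}{\pi}}\int_0^1t^{b-\frac32}(1-t)^{c-b-\frac32}e^{zt}K_{\nu+\frac12}\left(\frac{p}{t(1-t)}\right)dt.$$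 The $(p,\nu)$-extended Whittaker function is $$M_{\kappa,\mu}^{(p,\nu)}(z)=z^{\mu+\frac12}e^{-z/2}\,\Phi_{p,\nu}(\mu-\kappa+\tfrac12;2\mu+1;z),$$ with principal powers of $z$. *)

theory Defs
  imports "HOL-Analysis.Analysis"
begin

text \<open>
  The modified Bessel function of the second kind \<open>K\<^sub>a(z)\<close>, of arbitrary complex order, given by
  the classical integral (DLMF 10.32.9), which converges absolutely for \<open>Re z > 0\<close>.
  Unlike the formula in terms of the \<open>I\<close>-functions of orders \<open>a\<close> and \<open>-a\<close>, it needs no limit at integer orders.
  No meaning is attached to the value for \<open>Re z \<le> 0\<close>.
\<close>
definition bessel_K :: "complex \<Rightarrow> complex \<Rightarrow> complex" where
  "bessel_K a z =
     (LINT u:{0<..}|lborel. exp (- z * of_real (cosh u)) * cosh (a * of_real u))"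

definition ext_Beta :: "complex \<Rightarrow> real \<Rightarrow> complex \<Rightarrow> complex \<Rightarrow> complex" where
  "ext_Beta p \<nu> x y =
     csqrt (2 * p / of_real pi) *
     (LINT t:{0<..<1}|lborel.
        of_real t powr (x - 3/2) * of_real (1 - t) powr (y - 3/2) *
        bessel_K (of_real (\<nu> + 1/2)) (p / of_real (t * (1 - t))))"

definition ext_Phi :: "complex \<Rightarrow> real \<Rightarrow> complex \<Rightarrow> complex \<Rightarrow> complex \<Rightarrow> complex" where
  "ext_Phi p \<nu> b c z =
     (\<Sum>m. ext_Beta p \<nu> (b + of_nat m) (c - b) / Beta b (c - b) * z ^ m / fact m)"

definition ext_Whittaker_M ::
    "complex \<Rightarrow> real \<Rightarrow> complex \<Rightarrow> complex \<Rightarrow> complex \<Rightarrow> complex" where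
  "ext_Whittaker_M p \<nu> \<kappa> \<mu> z =
     z powr (\<mu> + 1/2) * exp (- z / 2) * ext_Phi p \<nu> (\<mu> - \<kappa> + 1/2) (2 * \<mu> + 1) z"

end

theory Submission
  imports Defs "HOL-Probability.Distributions" "HOL-Real_Asymp.Real_Asymp"
begin

text \<open>
  Both asymptotic steps are one application of Laplace's method. With \<open>w = 2l\<close> and \<open>u = v / sqrt l\<close>, the
  integral for \<open>K\<^sub>a(w)\<close> becomes a constant times \<open>exp (-w) / sqrt l\<close> times an integral against the kernel
  \<open>exp (-2l (cosh (v / sqrt l) - 1))\<close>, which is dominated by \<open>exp (-v\<^sup>2)\<close> and converges to it. So \<open>K\<^sub>a\<close> is its
  leading asymptotic term times a factor that is bounded for \<open>w\<close> away from \<open>0\<close> and tends to \<open>1\<close>, whatever \<open>a\<close>.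
  In the integral for \<open>\<Phi>\<close>, put \<open>t = 1 - s\<close> and \<open>s = (p/l) exp (v / sqrt l)\<close> with \<open>l = sqrt (p x)\<close>:
  then \<open>x s + p/s = 2l cosh (v / sqrt l)\<close>, the same kernel appears, and the remaining factor is bounded
  and tends to \<open>exp (-p)\<close>, since \<open>s \<rightarrow> 0\<close> for fixed \<open>v\<close>.
\<close>

subsection \<open>Laplace's method for the modified Bessel function\<close>

lemma sinh_real_ge: "x \<le> sinh x" if "x \<ge> 0" for x :: real
proof -
  have "sinh 0 - 0 \<le> sinh x - x"
  proof (rule DERIV_nonneg_imp_nondecreasing[OF that])
    fix y :: real
    show "\<exists>D. ((\<lambda>x. sinh x - x) has_real_derivative D) (at y) \<and> 0 \<le> D"
      by (rule exI[of _ "cosh y - 1"]) (auto intro!: derivative_eq_intros simp: cosh_real_ge_1)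
  qed
  thus ?thesis by simp
qed

text \<open>The half-angle identity cosh x = 1 + 2 sinh(x/2)^2 reduces this to sinh y >= y for y >=
  0. The absolute value lets that inequality be squared for negative x as well.\<close>

lemma cosh_real_ge: "1 + x\<^sup>2 / 2 \<le> cosh x" for x :: real
proof -
  have "(\<bar>x\<bar> / 2)\<^sup>2 \<le> (sinh (\<bar>x\<bar> / 2))\<^sup>2"
    using sinh_real_ge[of "\<bar>x\<bar> / 2"] by (intro power_mono) auto
  moreover have "cosh (2 * (\<bar>x\<bar> / 2)) = 1 + 2 * (sinh (\<bar>x\<bar> / 2))\<^sup>2"
    by (subst cosh_double) (simp add: cosh_square_eq)
  ultimately show ?thesis
    by (simp add: power_divide)
qed

section \<open>The rescaled kernel and its Gaussian limit\<close>

definition laplace_kernel :: "real \<Rightarrow> real \<Rightarrow> real" where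
  "laplace_kernel l v = exp (- 2 * l * (cosh (v / sqrt l) - 1))"

lemma laplace_kernel_measurable [measurable]: "laplace_kernel l \<in> borel_measurable borel"
  unfolding laplace_kernel_def cosh_def by measurable

lemma laplace_kernel_pos: "laplace_kernel l v > 0"
  by (simp add: laplace_kernel_def)

text \<open>The scaling v / sqrt l cancels the factor l in the quadratic lower bound for cosh, so
  the majorant is the same for all l > 0 and can serve in dominated convergence.\<close>

lemma laplace_kernel_le: "laplace_kernel l v \<le> exp (- v\<^sup>2)" if "l > 0"
proof -
  have "2 * l * ((v / sqrt l)\<^sup>2 / 2) \<le> 2 * l * (cosh (v / sqrt l) - 1)"
    using that cosh_real_ge[of "v / sqrt l"] by (intro mult_left_mono) auto
  moreover have "2 * l * ((v / sqrt l)\<^sup>2 / 2) = v\<^sup>2"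
    using that by (simp add: power_divide)
  ultimately show ?thesis
    by (simp add: laplace_kernel_def)
qed

lemma tendsto_laplace_kernel: "((\<lambda>l. laplace_kernel l v) \<longlongrightarrow> exp (- v\<^sup>2)) at_top"
proof -
  \<comment> \<open>The expansion of exp (v / sqrt l) at infinity has leading coefficients that
    depend on v, so the sign of v is fixed first.\<close>
  consider "v < 0" | "v = 0" | "v > 0" by linarith
  hence "((\<lambda>l. - 2 * l * ((exp (v / sqrt l) + exp (- (v / sqrt l))) / 2 - 1)) \<longlongrightarrow> - v\<^sup>2) at_top"
    by cases (real_asymp simp: power2_eq_square | simp)+
  thus ?thesis
    unfolding laplace_kernel_def by (intro tendsto_exp) (simp add: cosh_field_def)
qed

text \<open>Completing the square gives k|v| <= k^2/2 + v^2/2, which costs only half of the Gaussian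
  exponent; a multiple of the standard normal density is left.\<close>

lemma integrable_gaussian_exp_abs: "integrable lborel (\<lambda>v. exp (- v\<^sup>2) * exp (k * \<bar>v\<bar>))" for k :: real
proof (rule Bochner_Integration.integrable_bound)
  have "integrable lborel (\<lambda>v. exp (k\<^sup>2 / 2) * sqrt (2 * pi) * std_normal_density v)"
    by (intro integrable_mult_right integrable_normal_density) auto
  thus "integrable lborel (\<lambda>v. exp (k\<^sup>2 / 2) * exp (- v\<^sup>2 / 2))"
    by (simp add: std_normal_density_def mult.assoc)
  have "- v\<^sup>2 + k * \<bar>v\<bar> \<le> k\<^sup>2 / 2 - v\<^sup>2 / 2" for v :: real
    using zero_le_power2[of "k - \<bar>v\<bar>"] by (simp add: power2_diff)
  thus "AE v in lborel. norm (exp (- v\<^sup>2) * exp (k * \<bar>v\<bar>)) \<le> norm (exp (k\<^sup>2 / 2) * exp (- v\<^sup>2 / 2))"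
    by (simp flip: exp_add)
qed measurable

text \<open>Dominated convergence, with growth exp (k |v|) allowed as long as k does not depend on
  l. The general codomain lets it serve both the real integral for the Bessel function and the
  complex one for the confluent function.\<close>

lemma tendsto_integral_laplace_kernel:
  fixes \<phi> :: "real \<Rightarrow> real \<Rightarrow> 'a :: {banach, second_countable_topology}"
  assumes [measurable]: "\<And>l. \<phi> l \<in> borel_measurable borel"
    and bound: "\<forall>\<^sub>F l in at_top. \<forall>v. norm (\<phi> l v) \<le> C * exp (k * \<bar>v\<bar>)"
    and lim: "\<And>v. ((\<lambda>l. \<phi> l v) \<longlongrightarrow> \<psi> v) at_top"
    and [measurable]: "\<psi> \<in> borel_measurable borel"
  shows "((\<lambda>l. LINT v|lborel. laplace_kernel l v *\<^sub>R \<phi> l v) \<longlongrightarrow>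
           (LINT v|lborel. exp (- v\<^sup>2) *\<^sub>R \<psi> v)) at_top"
proof (rule integral_dominated_convergence_at_top)
  show "integrable lborel (\<lambda>v. C * (exp (- v\<^sup>2) * exp (k * \<bar>v\<bar>)))"
    by (intro integrable_mult_right integrable_gaussian_exp_abs)
  show "AE v in lborel. ((\<lambda>l. laplace_kernel l v *\<^sub>R \<phi> l v) \<longlongrightarrow> exp (- v\<^sup>2) *\<^sub>R \<psi> v) at_top"
    by (intro AE_I2 tendsto_scaleR tendsto_laplace_kernel lim)
  show "\<forall>\<^sub>F l in at_top. AE v in lborel. norm (laplace_kernel l v *\<^sub>R \<phi> l v) \<le>
          C * (exp (- v\<^sup>2) * exp (k * \<bar>v\<bar>))"
    using bound eventually_gt_at_top[of 0]
  proof eventually_elim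
    case (elim l)
    have "laplace_kernel l v * norm (\<phi> l v) \<le> exp (- v\<^sup>2) * (C * exp (k * \<bar>v\<bar>))" for v
      using elim laplace_kernel_le[of l v] by (intro mult_mono) auto
    thus ?case
      using laplace_kernel_pos[of l] by (intro AE_I2) (simp add: mult_ac less_imp_le)
  qed
qed measurable

text \<open>The quotient of \<open>K\<^sub>a(2l)\<close> and its leading asymptotic term \<open>sqrt (pi / (4l)) exp (-2l)\<close>.\<close>

definition bessel_K_ratio :: "real \<Rightarrow> real \<Rightarrow> real" where
  "bessel_K_ratio a l =
     2 / sqrt pi * (LINT v|lborel. laplace_kernel l v * (indicator {0<..} v * cosh (a * (v / sqrt l))))"

lemma bessel_K_ratio_measurable [measurable]: "bessel_K_ratio a \<in> borel_measurable borel"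
  unfolding bessel_K_ratio_def laplace_kernel_def cosh_def by measurable

lemma cosh_real_le_exp_abs: "cosh x \<le> exp \<bar>x\<bar>" for x :: real
  by (cases "x \<ge> 0") (auto simp: cosh_field_def)

text \<open>Replacing l by its lower bound \<open>l0\<close> makes the growth rate in |v|
  independent of l.\<close>

lemma cosh_scaled_le: "cosh (a * (v / sqrt l)) \<le> exp (\<bar>a\<bar> / sqrt l0 * \<bar>v\<bar>)"
  if "0 < l0" "l0 \<le> l" for a v l l0 :: real
proof -
  have "\<bar>a\<bar> * \<bar>v\<bar> / sqrt l \<le> \<bar>a\<bar> * \<bar>v\<bar> / sqrt l0"
    using that by (intro divide_left_mono) auto
  hence "\<bar>a * (v / sqrt l)\<bar> \<le> \<bar>a\<bar> / sqrt l0 * \<bar>v\<bar>"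
    using that by (simp add: abs_mult)
  thus ?thesis
    using cosh_real_le_exp_abs[of "a * (v / sqrt l)"] by (smt (verit) exp_le_cancel_iff)
qed

lemma tendsto_bessel_K_ratio: "(bessel_K_ratio a \<longlongrightarrow> 1) at_top"
proof -
  have "((\<lambda>l. LINT v|lborel. laplace_kernel l v *\<^sub>R (indicator {0<..} v * cosh (a * (v / sqrt l)))) \<longlongrightarrow>
           (LINT v|lborel. exp (- v\<^sup>2) *\<^sub>R indicator {0<..} v)) at_top"
  proof (rule tendsto_integral_laplace_kernel)
    show "\<forall>\<^sub>F l in at_top. \<forall>v. norm (indicator {0<..} v * cosh (a * (v / sqrt l))) \<le> 1 * exp (\<bar>a\<bar> / sqrt 1 * \<bar>v\<bar>)"
      using eventually_ge_at_top[of 1]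
    proof eventually_elim
      case (elim l)
      have "norm (indicator {0<..} v * cosh (a * (v / sqrt l))) \<le> 1 * exp (\<bar>a\<bar> / sqrt 1 * \<bar>v\<bar>)" for v
        using elim cosh_scaled_le[of 1 l a v] by (cases "v > 0") auto
      thus ?case by blast
    qed
    show "((\<lambda>l. indicator {0<..} v * cosh (a * (v / sqrt l))) \<longlongrightarrow> indicator {0<..} v) at_top" for v :: real
    proof -
      have "((\<lambda>l. v / sqrt l) \<longlongrightarrow> 0) at_top"
        by (intro real_tendsto_divide_at_top[OF tendsto_const] sqrt_at_top)
      hence "((\<lambda>l. indicator {0<..} v * cosh (a * (v / sqrt l))) \<longlongrightarrow> indicator {0<..} v * cosh (a * 0)) at_top"
        by (intro tendsto_intros)
      thus ?thesis by simp
    qed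
  qed (unfold cosh_def, measurable)
  \<comment> \<open>\<open>gaussian_moment_0\<close> integrates over the closed half-line; the extra
    point 0 is a null set.\<close>
  also have "(LINT v|lborel. exp (- v\<^sup>2) *\<^sub>R indicator {0<..} v) =
             (LINT v|lborel. indicator {0..} v *\<^sub>R exp (- v\<^sup>2 :: real))"
    by (intro integral_cong_AE) (use AE_lborel_singleton[of "0::real"] in \<open>auto simp: indicator_def\<close>)
  also have "\<dots> = sqrt pi / 2"
    using gaussian_moment_0 by (rule has_bochner_integral_integral_eq)
  finally have "((\<lambda>l. 2 / sqrt pi * (LINT v|lborel. laplace_kernel l v * (indicator {0<..} v * cosh (a * (v / sqrt l)))))
                  \<longlongrightarrow> 2 / sqrt pi * (sqrt pi / 2)) at_top"
    by (intro tendsto_intros) simp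
  thus ?thesis
    by (simp add: bessel_K_ratio_def[abs_def])
qed

text \<open>The limit controls only large l. In the integral for the confluent function the argument
  also takes moderate values, where this bound supplies the domination.\<close>

lemma bessel_K_ratio_bounded:
  assumes "0 < l0"
  obtains C where "\<And>l. l \<ge> l0 \<Longrightarrow> \<bar>bessel_K_ratio a l\<bar> \<le> C"
proof
  fix l assume l: "l \<ge> l0"
  let ?f = "\<lambda>v. laplace_kernel l v * (indicator {0<..} v * cosh (a * (v / sqrt l)))"
  have nonneg: "?f v \<ge> 0" for v
    using laplace_kernel_pos[of l v] by (auto simp: indicator_def intro!: mult_nonneg_nonneg)
  have "integral\<^sup>L lborel ?f \<le> (LINT v|lborel. exp (- v\<^sup>2) * exp (\<bar>a\<bar> / sqrt l0 * \<bar>v\<bar>))"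
  proof (rule integral_mono')
    show "?f v \<le> exp (- v\<^sup>2) * exp (\<bar>a\<bar> / sqrt l0 * \<bar>v\<bar>)" for v
      using assms l cosh_scaled_le[of l0 l a v] laplace_kernel_le[of l v] laplace_kernel_pos[of l v]
      by (intro mult_mono) (auto simp: indicator_def)
  qed (rule integrable_gaussian_exp_abs, simp)
  moreover have "integral\<^sup>L lborel ?f \<ge> 0"
    using nonneg by (intro integral_nonneg_AE) auto
  ultimately show "\<bar>bessel_K_ratio a l\<bar> \<le>
      2 / sqrt pi * (LINT v|lborel. exp (- v\<^sup>2) * exp (\<bar>a\<bar> / sqrt l0 * \<bar>v\<bar>))"
    unfolding bessel_K_ratio_def abs_mult by (intro mult_mono) auto
qed

lemma cosh_of_real: "cosh (of_real x) = (of_real (cosh x) :: complex)"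
  by (simp add: cosh_field_def exp_of_real flip: of_real_minus)

lemma bessel_K_eq_ratio:
  assumes "l > 0"
  shows "bessel_K (of_real a) (of_real (2 * l)) =
           of_real (sqrt pi / (2 * sqrt l) * exp (- (2 * l)) * bessel_K_ratio a l)"
proof -
  have "bessel_K (of_real a) (of_real (2 * l)) =
          (LINT u|lborel. complex_of_real (indicator {0<..} u * (exp (- (2 * l) * cosh u) * cosh (a * u))))"
    unfolding bessel_K_def set_lebesgue_integral_def
    by (intro Bochner_Integration.integral_cong refl)
       (simp add: scaleR_conv_of_real exp_of_real cosh_of_real flip: of_real_mult of_real_minus)
  also have "\<dots> = of_real (LINT u|lborel. indicator {0<..} u * (exp (- (2 * l) * cosh u) * cosh (a * u)))"
    by (rule integral_complex_of_real)
  also have "(LINT u|lborel. indicator {0<..} u * (exp (- (2 * l) * cosh u) * cosh (a * u))) =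
      1 / sqrt l * (LINT v|lborel. indicator {0<..} (v / sqrt l) *
        (exp (- (2 * l) * cosh (v / sqrt l)) * cosh (a * (v / sqrt l))))"
    \<comment> \<open>The substitution is u = v / sqrt l, with Jacobian 1 / sqrt l.\<close>
    using assms by (subst lborel_integral_real_affine[of "1 / sqrt l" _ 0]) auto
  also have "(LINT v|lborel. indicator {0<..} (v / sqrt l) *
        (exp (- (2 * l) * cosh (v / sqrt l)) * cosh (a * (v / sqrt l)))) =
      (LINT v|lborel. exp (- (2 * l)) *
        (laplace_kernel l v * (indicator {0<..} v * cosh (a * (v / sqrt l)))))"
    using assms
    by (intro Bochner_Integration.integral_cong refl)
       (auto simp: laplace_kernel_def indicator_def algebra_simps zero_less_divide_iff simp flip: exp_add)
  finally show ?thesis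
    by (simp add: bessel_K_ratio_def)
qed

subsection \<open>Integral representation of the extended confluent hypergeometric function\<close>

lemma of_real_powr_eq_exp: "of_real x powr w = exp (w * of_real (ln x))" if "x > 0" for x :: real and w :: complex
  using that by (simp add: powr_def Ln_of_real)

text \<open>The factor exp (- p/t) tames every real power of t at 0. This follows from ln y <= y - 1
  at y = e/t.\<close>

lemma exp_ln_minus_inverse_bounded:
  fixes p \<beta> :: real
  assumes "p > 0"
  obtains C where "C > 0" "\<And>t. t > 0 \<Longrightarrow> t < 1 \<Longrightarrow> exp (\<beta> * ln t - p / t) \<le> C"
proof
  \<comment> \<open>Chosen so that the term |\<beta>| e / t is absorbed by p / t; the summand 1
    keeps the denominator positive when \<beta> = 0.\<close>
  define e where "e = p / (\<bar>\<beta>\<bar> + 1)"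
  have e: "e > 0" "\<bar>\<beta>\<bar> * e \<le> p"
    using assms by (auto simp: e_def field_simps)
  fix t :: real assume t: "t > 0" "t < 1"
  have "ln (e / t) \<le> e / t - 1"
    using e t by (intro ln_le_minus_one) auto
  hence "- ln t \<le> e / t - 1 - ln e"
    using e t by (simp add: ln_div)
  hence "\<bar>\<beta>\<bar> * (- ln t) \<le> \<bar>\<beta>\<bar> * (e / t - 1 - ln e)"
    by (intro mult_left_mono) auto
  moreover have "\<beta> * ln t \<le> \<bar>\<beta>\<bar> * (- ln t)"
  proof -
    have "(- \<beta>) * (- ln t) \<le> \<bar>\<beta>\<bar> * (- ln t)"
      using t by (intro mult_right_mono) auto
    thus ?thesis by simp
  qed
  moreover have "(\<bar>\<beta>\<bar> * e) / t \<le> p / t"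
    using e t by (intro divide_right_mono) auto
  ultimately have "\<beta> * ln t - p / t \<le> \<bar>\<beta>\<bar> * (- 1 - ln e)"
    by (simp add: algebra_simps)
  thus "exp (\<beta> * ln t - p / t) \<le> exp (\<bar>\<beta>\<bar> * (- 1 - ln e))"
    by simp
qed simp

text \<open>The integrand of \<open>\<Phi>\<close> without the factor \<open>exp (z t)\<close>; \<open>d\<close> stands for \<open>c - b\<close> and \<open>a\<close> for \<open>\<nu> + 1/2\<close>.\<close>

definition ext_integrand :: "real \<Rightarrow> real \<Rightarrow> complex \<Rightarrow> complex \<Rightarrow> real \<Rightarrow> complex" where
  "ext_integrand p a b d t =
     exp ((b - 1) * of_real (ln t) + (d - 1) * of_real (ln (1 - t)) - of_real (p / t + p / (1 - t))) *
     of_real (bessel_K_ratio a (p / (2 * (t * (1 - t)))))"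

lemma ext_integrand_measurable [measurable]: "ext_integrand p a b d \<in> borel_measurable borel"
  unfolding ext_integrand_def by measurable

text \<open>With l = p / (2 t (1 - t)), the prefactor sqrt (2p/pi) times the factor sqrt (pi / (4l))
  of the Bessel asymptotics is sqrt (t (1 - t)). This raises both exponents by 1/2, and 1/(t (1 -
  t)) = 1/t + 1/(1 - t) splits the exponential.\<close>

lemma ext_Beta_integrand_eq:
  fixes p a t :: real
  assumes "p > 0" "0 < t" "t < 1"
  shows "csqrt (2 * of_real p / of_real pi) *
          (of_real t powr (b - 3/2) * of_real (1 - t) powr (d - 3/2) *
            bessel_K (of_real a) (of_real p / of_real (t * (1 - t)))) = ext_integrand p a b d t"
proof -
  define l where "l = p / (2 * (t * (1 - t)))"
  have l: "l > 0"
    using assms by (simp add: l_def)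
  have p_eq: "p = 2 * l * (t * (1 - t))"
    using assms by (simp add: l_def)
  have csqrt: "csqrt (2 * of_real p / of_real pi) = of_real (sqrt (2 * p / pi))"
    using assms by (subst of_real_sqrt) auto
  have "sqrt (2 * p / pi) * (sqrt pi / (2 * sqrt l)) = sqrt (t * (1 - t))"
    using l assms by (simp add: p_eq real_sqrt_mult real_sqrt_divide)
  also have "\<dots> = exp (ln (sqrt (t * (1 - t))))"
    using assms by simp
  also have "ln (sqrt (t * (1 - t))) = (ln t + ln (1 - t)) / 2"
    using assms by (simp add: ln_sqrt ln_mult)
  finally have const: "sqrt (2 * p / pi) * (sqrt pi / (2 * sqrt l)) = exp ((ln t + ln (1 - t)) / 2)" .
  have arg: "of_real p / of_real (t * (1 - t)) = (of_real (2 * l) :: complex)"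
    using assms by (simp add: l_def)
  have l_eq: "2 * l = p / t + p / (1 - t)"
    using assms by (simp add: l_def field_simps)
  have powrs: "of_real t powr (b - 3/2) = exp ((b - 3/2) * of_real (ln t))"
       "of_real (1 - t) powr (d - 3/2) = exp ((d - 3/2) * of_real (ln (1 - t)))"
    using assms by (simp_all add: of_real_powr_eq_exp del: of_real_diff)
  have "csqrt (2 * of_real p / of_real pi) *
          (of_real t powr (b - 3/2) * of_real (1 - t) powr (d - 3/2) *
            bessel_K (of_real a) (of_real p / of_real (t * (1 - t)))) =
        of_real (sqrt (2 * p / pi) * (sqrt pi / (2 * sqrt l))) *
          (exp ((b - 3/2) * of_real (ln t)) * exp ((d - 3/2) * of_real (ln (1 - t)))) *
          of_real (exp (- (2 * l)) * bessel_K_ratio a l)"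
    unfolding csqrt arg powrs bessel_K_eq_ratio[OF l] by (simp only: of_real_mult mult_ac)
  also have "\<dots> = of_real (exp ((ln t + ln (1 - t)) / 2)) *
          (exp ((b - 3/2) * of_real (ln t)) * exp ((d - 3/2) * of_real (ln (1 - t)))) *
          of_real (exp (- (p / t + p / (1 - t))) * bessel_K_ratio a l)"
    unfolding const l_eq ..
  also have "\<dots> = exp (of_real ((ln t + ln (1 - t)) / 2) +
        (b - 3/2) * of_real (ln t) + (d - 3/2) * of_real (ln (1 - t)) - of_real (p / t + p / (1 - t))) *
      of_real (bessel_K_ratio a l)"
    by (simp only: of_real_mult of_real_minus diff_conv_add_uminus exp_add mult_ac flip: exp_of_real)
  also have "of_real ((ln t + ln (1 - t)) / 2) + (b - 3/2) * of_real (ln t) + (d - 3/2) * of_real (ln (1 - t)) =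
      (b - 1) * of_real (ln t) + (d - 1) * of_real (ln (1 - t))"
    by (simp add: field_simps)
  finally show ?thesis
    by (simp add: ext_integrand_def l_def)
qed

lemma mult_one_minus_le_quarter: "t * (1 - t) \<le> 1 / 4" for t :: real
  using zero_le_power2[of "t - 1/2"] by (simp add: power2_eq_square algebra_simps)

lemma bessel_K_ratio_unit_interval_bounded:
  assumes "p > 0"
  obtains C where "C > 0" "\<And>t. 0 < t \<Longrightarrow> t < 1 \<Longrightarrow> \<bar>bessel_K_ratio a (p / (2 * (t * (1 - t))))\<bar> \<le> C"
proof -
  \<comment> \<open>Since t (1 - t) <= 1/4, the argument p / (2 t (1 - t)) never falls below
    2p.\<close>
  obtain C where C: "\<And>l. l \<ge> 2 * p \<Longrightarrow> \<bar>bessel_K_ratio a l\<bar> \<le> C"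
    using assms bessel_K_ratio_bounded[of "2 * p"] by auto
  show ?thesis
  proof (rule that[of "max C 1"])
    fix t :: real assume t: "0 < t" "t < 1"
    have "2 * p * (2 * (t * (1 - t))) \<le> 2 * p * (2 * (1 / 4))"
      using assms mult_one_minus_le_quarter[of t] by (intro mult_left_mono) auto
    hence "2 * p \<le> p / (2 * (t * (1 - t)))"
      using t by (subst pos_le_divide_eq) auto
    thus "\<bar>bessel_K_ratio a (p / (2 * (t * (1 - t))))\<bar> \<le> max C 1"
      using C by fastforce
  qed simp
qed

text \<open>The factors exp (- p/t) and exp (- p/(1 - t)) cancel the possible singularities at the
  two endpoints, for arbitrary complex exponents.\<close>

lemma ext_integrand_bounded:
  assumes "p > 0"
  obtains C where "C > 0" "\<And>t. 0 < t \<Longrightarrow> t < 1 \<Longrightarrow> norm (ext_integrand p a b d t) \<le> C"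
proof -
  obtain C1 where C1: "C1 > 0" "\<And>t. t > 0 \<Longrightarrow> t < 1 \<Longrightarrow> exp (Re (b - 1) * ln t - p / t) \<le> C1"
    using exp_ln_minus_inverse_bounded[OF assms] by metis
  obtain C2 where C2: "C2 > 0" "\<And>t. t > 0 \<Longrightarrow> t < 1 \<Longrightarrow> exp (Re (d - 1) * ln t - p / t) \<le> C2"
    using exp_ln_minus_inverse_bounded[OF assms] by metis
  obtain C3 where C3: "C3 > 0" "\<And>t. 0 < t \<Longrightarrow> t < 1 \<Longrightarrow> \<bar>bessel_K_ratio a (p / (2 * (t * (1 - t))))\<bar> \<le> C3"
    using bessel_K_ratio_unit_interval_bounded[OF assms] by metis
  show ?thesis
  proof (rule that[of "C1 * C2 * C3"])
    fix t :: real assume t: "0 < t" "t < 1"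
    have "norm (ext_integrand p a b d t) =
        exp (Re (b - 1) * ln t - p / t) * exp (Re (d - 1) * ln (1 - t) - p / (1 - t)) *
        \<bar>bessel_K_ratio a (p / (2 * (t * (1 - t))))\<bar>"
      by (simp add: ext_integrand_def norm_mult algebra_simps flip: exp_add)
    also have "\<dots> \<le> C1 * C2 * C3"
      using t C1 C2 C3 by (intro mult_mono) auto
    finally show "norm (ext_integrand p a b d t) \<le> C1 * C2 * C3" .
  qed (use C1 C2 C3 in auto)
qed

lemma ext_integrand_add_nat:
  assumes "t > 0"
  shows "ext_integrand p a (b + of_nat m) d t = ext_integrand p a b d t * of_real t ^ m"
proof -
  have "exp (of_nat m * complex_of_real (ln t)) = of_real t ^ m"
    using assms by (simp add: exp_of_nat_mult exp_of_real)
  thus ?thesis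
    by (simp add: ext_integrand_def ring_distribs exp_add exp_diff field_simps)
qed

lemma ext_Beta_add_nat:
  assumes "p > 0"
  shows "ext_Beta (of_real p) \<nu> (b + of_nat m) d =
           (LINT t:{0<..<1}|lborel. ext_integrand p (\<nu> + 1/2) b d t * of_real t ^ m)"
  unfolding ext_Beta_def set_integral_mult_right[symmetric]
proof (rule set_lebesgue_integral_cong, simp, intro allI impI)
  fix t :: real assume t: "t \<in> {0<..<1}"
  show "csqrt (2 * of_real p / of_real pi) *
          (of_real t powr (b + of_nat m - 3/2) * of_real (1 - t) powr (d - 3/2) *
            bessel_K (of_real (\<nu> + 1/2)) (of_real p / of_real (t * (1 - t)))) =
          ext_integrand p (\<nu> + 1/2) b d t * of_real t ^ m"
    using t assms by (subst ext_Beta_integrand_eq) (simp_all add: ext_integrand_add_nat)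
qed

text \<open>Raising b by m multiplies the integrand by t^m, so the series is the termwise integral
  of the expansion of exp (z t). The bound C |z|^m / m! on the interval (0,1) justifies the
  interchange.\<close>

lemma ext_Phi_eq_integral:
  assumes "p > 0"
  shows "ext_Phi (of_real p) \<nu> b c z =
           (LINT t:{0<..<1}|lborel. ext_integrand p (\<nu> + 1/2) b (c - b) t * exp (z * of_real t)) / Beta b (c - b)"
proof -
  define F where "F = ext_integrand p (\<nu> + 1/2) b (c - b)"
  have F_meas [measurable]: "F \<in> borel_measurable borel"
    by (simp add: F_def)
  obtain C where C: "C > 0" "\<And>t. 0 < t \<Longrightarrow> t < 1 \<Longrightarrow> norm (F t) \<le> C"
    unfolding F_def using ext_integrand_bounded[OF assms] by metis
  define f where "f = (\<lambda>m t. indicator {0<..<1} t *\<^sub>R (F t * ((z * of_real t) ^ m /\<^sub>R fact m)))"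
  have f_meas [measurable]: "f m \<in> borel_measurable borel" for m
    unfolding f_def by measurable
  have f_le: "norm (f m t) \<le> indicator {0<..<1} t * (C * (norm z ^ m /\<^sub>R fact m))" for m t
  proof (cases "t \<in> {0<..<1}")
    case True
    have "norm (F t) * (norm z ^ m * \<bar>t\<bar> ^ m / fact m) \<le> C * (norm z ^ m * 1 / fact m)"
      using True C by (intro mult_mono divide_right_mono mult_left_mono power_le_one) auto
    thus ?thesis
      using True by (simp add: f_def norm_mult norm_power power_mult_distrib divide_inverse mult_ac)
  qed (simp add: f_def)
  have int_bound: "integrable lborel (\<lambda>t::real. indicator {0<..<1} t * (C * (norm z ^ m /\<^sub>R fact m)))" for m
    by (intro integrable_mult_left integrable_real_indicator) auto
  have int_f: "integrable lborel (f m)" for m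
    using f_le[of m] by (intro Bochner_Integration.integrable_bound[OF int_bound[of m]]) (auto intro!: AE_I2 order.trans[OF f_le])
  have sum_f: "(\<lambda>m. f m t) sums (indicator {0<..<1} t *\<^sub>R (F t * exp (z * of_real t)))" for t
    unfolding f_def by (intro sums_scaleR_right sums_mult exp_converges)
  have "(\<lambda>m. integral\<^sup>L lborel (f m)) sums (LINT t|lborel. (\<Sum>m. f m t))"
  proof (rule sums_integral[OF int_f])
    have "summable (\<lambda>m. norm (f m t))" for t
    proof (rule summable_comparison_test[OF exI, OF allI, OF impI])
      show "summable (\<lambda>m. indicator {0<..<1} t * (C * (norm z ^ m /\<^sub>R fact m)))"
        by (intro summable_mult summable_exp_generic)
      show "norm (norm (f m t)) \<le> indicator {0<..<1} t * (C * (norm z ^ m /\<^sub>R fact m))" for m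
        using f_le by simp
    qed
    thus "AE t in lborel. summable (\<lambda>m. norm (f m t))" by simp
    show "summable (\<lambda>m. LINT t|lborel. norm (f m t))"
    proof (rule summable_comparison_test[OF exI, OF allI, OF impI])
      show "summable (\<lambda>m. C * (norm z ^ m /\<^sub>R fact m))"
        by (intro summable_mult summable_exp_generic)
      fix m
      have "(LINT t|lborel. norm (f m t)) \<le> (LINT t::real|lborel. indicator {0<..<1} t * (C * (norm z ^ m /\<^sub>R fact m)))"
        by (intro integral_mono int_bound integrable_norm int_f f_le)
      thus "norm (LINT t|lborel. norm (f m t)) \<le> C * (norm z ^ m /\<^sub>R fact m)"
        by (simp add: integral_nonneg_AE)
    qed
  qed
  also have "(LINT t|lborel. (\<Sum>m. f m t)) = (LINT t:{0<..<1}|lborel. F t * exp (z * of_real t))"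
    using sum_f by (simp add: set_lebesgue_integral_def sums_iff)
  finally have "(\<lambda>m. integral\<^sup>L lborel (f m) / Beta b (c - b)) sums
      ((LINT t:{0<..<1}|lborel. F t * exp (z * of_real t)) / Beta b (c - b))"
    by (rule sums_divide)
  moreover have "integral\<^sup>L lborel (f m) = ext_Beta (of_real p) \<nu> (b + of_nat m) (c - b) * (z ^ m / fact m)" for m
    unfolding ext_Beta_add_nat[OF assms] set_integral_mult_left[symmetric] F_def[symmetric]
    by (simp add: set_lebesgue_integral_def f_def power_mult_distrib scaleR_conv_of_real field_simps)
  ultimately show ?thesis
    by (simp add: ext_Phi_def sums_iff F_def mult_ac)
qed

subsection \<open>Laplace's method for the extended confluent hypergeometric function\<close>

lemma integral_exp_substitution:
  fixes f :: "real \<Rightarrow> complex"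
  assumes f: "set_integrable lborel {0<..} f" and [measurable]: "f \<in> borel_measurable borel"
    and "q > 0" "k > 0"
  shows "(LINT s:{0<..}|lborel. f s) = (LINT v|lborel. (k * (q * exp (k * v))) *\<^sub>R f (q * exp (k * v)))"
proof -
  let ?g = "\<lambda>v. q * exp (k * v)"
  let ?F = "\<lambda>v. (k * (q * exp (k * v))) *\<^sub>R f (q * exp (k * v))"
  have surj: "range ?g = {0<..}"
  proof (intro equalityI subsetI)
    fix s :: real assume "s \<in> {0<..}"
    hence "s = ?g (ln (s / q) / k)"
      using assms by simp
    thus "s \<in> range ?g" by blast
  qed (use assms in auto)
  \<comment> \<open>The change of variables theorem speaks about the completed measure; Borel
    measurability of the integrands allows passing from \<open>lborel\<close> to it and
    back.\<close>
  have f': "f absolutely_integrable_on {0<..}"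
    using f unfolding set_integrable_def by (subst integrable_completion) auto
  have "(\<lambda>v. \<bar>k * (q * exp (k * v))\<bar> *\<^sub>R f (?g v)) absolutely_integrable_on UNIV \<and>
      integral UNIV (\<lambda>v. \<bar>k * (q * exp (k * v))\<bar> *\<^sub>R f (?g v)) = integral {0<..} f"
    by (subst has_absolute_integral_change_of_variables_real)
       (use assms f' surj in \<open>auto simp: inj_on_def intro!: derivative_eq_intros\<close>)
  hence *: "?F absolutely_integrable_on UNIV" "integral UNIV ?F = integral {0<..} f"
    using assms by (simp_all add: abs_mult)
  have "set_integrable lborel UNIV ?F"
    using *(1) unfolding set_integrable_def by (subst (asm) integrable_completion) auto
  from set_borel_integral_eq_integral(2)[OF this] set_borel_integral_eq_integral(2)[OF f] *(2)
  show ?thesis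
    by (simp add: set_lebesgue_integral_def)
qed

text \<open>What is left of the integrand at \<open>t = 1 - s\<close> besides \<open>s powr (d - 1) * exp (x - x s - p/s)\<close>.\<close>

definition ext_amplitude :: "real \<Rightarrow> real \<Rightarrow> complex \<Rightarrow> real \<Rightarrow> complex" where
  "ext_amplitude p a b s = indicator {0<..<1} s *\<^sub>R
     (exp ((b - 1) * of_real (ln (1 - s)) - of_real (p / (1 - s))) *
      of_real (bessel_K_ratio a (p / (2 * (s * (1 - s))))))"

lemma ext_amplitude_measurable [measurable]: "ext_amplitude p a b \<in> borel_measurable borel"
  unfolding ext_amplitude_def by measurable

text \<open>The bound covers all real s, since s = (p/l) exp (v / sqrt l) runs through all positive
  reals. The power of s is not part of the amplitude, so only the singularity at s = 1 has to be
  cancelled.\<close>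

lemma ext_amplitude_bounded:
  assumes "p > 0"
  obtains C where "C > 0" "\<And>s. norm (ext_amplitude p a b s) \<le> C"
proof -
  obtain C1 where C1: "C1 > 0" "\<And>t. t > 0 \<Longrightarrow> t < 1 \<Longrightarrow> exp (Re (b - 1) * ln t - p / t) \<le> C1"
    using exp_ln_minus_inverse_bounded[OF assms] by metis
  obtain C2 where C2: "C2 > 0" "\<And>t. 0 < t \<Longrightarrow> t < 1 \<Longrightarrow> \<bar>bessel_K_ratio a (p / (2 * (t * (1 - t))))\<bar> \<le> C2"
    using bessel_K_ratio_unit_interval_bounded[OF assms] by metis
  show ?thesis
  proof (rule that[of "C1 * C2"])
    fix s :: real
    show "norm (ext_amplitude p a b s) \<le> C1 * C2"
    proof (cases "s \<in> {0<..<1}")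
      case True
      hence "norm (ext_amplitude p a b s) =
          exp (Re (b - 1) * ln (1 - s) - p / (1 - s)) * \<bar>bessel_K_ratio a (p / (2 * (s * (1 - s))))\<bar>"
        by (simp add: ext_amplitude_def norm_mult)
      also have "\<dots> \<le> C1 * C2"
        using True C1 C2 by (intro mult_mono) auto
      finally show ?thesis .
    qed (use C1 C2 in \<open>auto simp: ext_amplitude_def\<close>)
  qed (use C1 C2 in auto)
qed

text \<open>This is where the order drops out: as s -> 0 the Bessel argument tends to infinity, and
  the ratio tends to 1 for every order. The constant exp (- p) comes from exp (- p/(1 - s)).\<close>

lemma tendsto_ext_amplitude:
  assumes "p > 0"
  shows "(ext_amplitude p a b \<longlongrightarrow> of_real (exp (- p))) (at_right 0)"
proof -
  have "LIM s at_right 0. p / (2 * (s * (1 - s))) :> at_top"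
    using assms by real_asymp
  hence "((\<lambda>s. bessel_K_ratio a (p / (2 * (s * (1 - s))))) \<longlongrightarrow> 1) (at_right 0)"
    by (rule filterlim_compose[OF tendsto_bessel_K_ratio])
  hence "((\<lambda>s. exp ((b - 1) * of_real (ln (1 - s)) - of_real (p / (1 - s))) *
      of_real (bessel_K_ratio a (p / (2 * (s * (1 - s)))))) \<longlongrightarrow>
      exp ((b - 1) * of_real (ln (1 - 0)) - of_real (p / (1 - 0))) * of_real 1) (at_right 0)"
    by (intro tendsto_intros) auto
  moreover have "\<forall>\<^sub>F s in at_right 0. exp ((b - 1) * of_real (ln (1 - s)) - of_real (p / (1 - s))) *
      of_real (bessel_K_ratio a (p / (2 * (s * (1 - s))))) = ext_amplitude p a b s"
    using eventually_at_right_real[of 0 1]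
    by (auto elim!: eventually_mono simp: ext_amplitude_def)
  ultimately show ?thesis
    by (simp add: tendsto_cong exp_of_real flip: of_real_minus)
qed

text \<open>For x = l^2 / p, the function x s + p/s on s > 0 has its minimum 2l at s = p/l.
  Measuring ln s from that point, on the scale 1 / sqrt l, makes the phase an exact cosh.\<close>

lemma ext_integral_eq_laplace:
  fixes a l p :: real and b d :: complex
  assumes "p > 0" "l > 0"
  shows "(LINT t:{0<..<1}|lborel. ext_integrand p a b d t * exp (of_real (l\<^sup>2 / p) * of_real t)) =
     of_real (exp (l\<^sup>2 / p - 2 * l) / sqrt l) * exp (d * of_real (ln (p / l))) *
     (LINT v|lborel. laplace_kernel l v *\<^sub>R
        (exp (d * of_real (v / sqrt l)) * ext_amplitude p a b (p / l * exp (v / sqrt l))))"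
proof -
  define g where "g s = ext_integrand p a b d (1 - s) * exp (of_real (l\<^sup>2 / p) * of_real (1 - s))" for s
  define f where "f s = indicator {0<..<1} s *\<^sub>R g s" for s
  have [measurable]: "g \<in> borel_measurable borel" "f \<in> borel_measurable borel"
    unfolding f_def g_def by measurable
  obtain C where C: "C > 0" "\<And>t. 0 < t \<Longrightarrow> t < 1 \<Longrightarrow> norm (ext_integrand p a b d t) \<le> C"
    using ext_integrand_bounded[OF assms(1)] by metis
  have "norm (f s) \<le> indicator {0<..<1} s * (C * exp (l\<^sup>2 / p))" for s
  proof (cases "s \<in> {0<..<1}")
    case True
    have "l\<^sup>2 / p * (1 - s) \<le> l\<^sup>2 / p * 1"
      using assms True by (intro mult_left_mono) auto
    hence "exp (l\<^sup>2 / p * (1 - s)) \<le> exp (l\<^sup>2 / p)"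
      by simp
    hence "norm (ext_integrand p a b d (1 - s)) * exp (l\<^sup>2 / p * (1 - s)) \<le> C * exp (l\<^sup>2 / p)"
      using True C by (intro mult_mono) auto
    thus ?thesis
      using True by (simp add: f_def g_def norm_mult)
  qed (simp add: f_def)
  \<comment> \<open>A bounded function supported on (0,1); integrability is a premise of
    \<open>integral_exp_substitution\<close>.\<close>
  hence "integrable lborel f"
    by (intro Bochner_Integration.integrable_bound[of lborel "\<lambda>s. indicator {0<..<1} s * (C * exp (l\<^sup>2 / p))" f]
          integrable_mult_left integrable_real_indicator)
       (auto intro!: AE_I2 intro: order.trans[OF _ abs_ge_self])
  moreover have f_eq: "indicator {0<..} s *\<^sub>R f s = f s" for s
    by (simp add: f_def indicator_def)
  ultimately have int_f: "set_integrable lborel {0<..} f"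
    by (simp add: set_integrable_def)
  have "(LINT t:{0<..<1}|lborel. ext_integrand p a b d t * exp (of_real (l\<^sup>2 / p) * of_real t)) =
        (LINT s|lborel. f s)"
    unfolding set_lebesgue_integral_def
    \<comment> \<open>The reflection t = 1 - s moves the growth of exp (x t) from t = 1 to s =
      0.\<close>
    by (subst lborel_integral_real_affine[of "-1" _ 1])
       (auto intro!: Bochner_Integration.integral_cong simp: f_def g_def indicator_def)
  also have "\<dots> = (LINT s:{0<..}|lborel. f s)"
    by (simp add: set_lebesgue_integral_def f_eq)
  also have "\<dots> = (LINT v|lborel. (1 / sqrt l * (p / l * exp (1 / sqrt l * v))) *\<^sub>R f (p / l * exp (1 / sqrt l * v)))"
    using assms by (intro integral_exp_substitution int_f) auto
  also have "\<dots> = (LINT v|lborel. of_real (exp (l\<^sup>2 / p - 2 * l) / sqrt l) * exp (d * of_real (ln (p / l))) *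
     (laplace_kernel l v *\<^sub>R
        (exp (d * of_real (v / sqrt l)) * ext_amplitude p a b (p / l * exp (v / sqrt l)))))"
  proof (intro Bochner_Integration.integral_cong refl)
    fix v :: real
    define y where "y = v / sqrt l"
    define s where "s = p / l * exp y"
    have s: "s > 0"
      using assms by (simp add: s_def)
    have ln_s: "ln s = ln (p / l) + y"
      unfolding s_def using assms by (subst ln_mult) auto
    have "(1 / sqrt l * s) *\<^sub>R f s =
      of_real (exp (l\<^sup>2 / p - 2 * l) / sqrt l) * exp (d * of_real (ln (p / l))) *
       (laplace_kernel l v *\<^sub>R (exp (d * of_real y) * ext_amplitude p a b s))"
    \<comment> \<open>For s >= 1 the indicators in \<open>f\<close> and \<open>ext_amplitude\<close>
      make both sides vanish.\<close>
    proof (cases "s < 1")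
      case True
      have exponent: "p / s + l\<^sup>2 / p * s = 2 * l * cosh y"
        using assms by (simp add: s_def cosh_field_def exp_minus field_simps power2_eq_square)
      \<comment> \<open>The Jacobian contributes exp (ln s), which turns the exponent d - 1 of s
        into d.\<close>
      have "(1 / sqrt l * s) *\<^sub>R f s = of_real (1 / sqrt l) *
          exp (of_real (ln s) + ((b - 1) * of_real (ln (1 - s)) + (d - 1) * of_real (ln s) - of_real (p / (1 - s) + p / s))
               + of_real (l\<^sup>2 / p * (1 - s))) *
          of_real (bessel_K_ratio a (p / (2 * (s * (1 - s)))))"
        using s True
        by (simp add: f_def g_def ext_integrand_def scaleR_conv_of_real exp_add exp_of_real mult_ac)
      also have "of_real (ln s) + ((b - 1) * of_real (ln (1 - s)) + (d - 1) * of_real (ln s) - of_real (p / (1 - s) + p / s))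
               + of_real (l\<^sup>2 / p * (1 - s)) =
          d * of_real (ln s) + of_real (l\<^sup>2 / p - (p / s + l\<^sup>2 / p * s)) + ((b - 1) * of_real (ln (1 - s)) - of_real (p / (1 - s)))"
        by (simp add: algebra_simps diff_divide_distrib)
      also have "of_real (1 / sqrt l) * exp \<dots> * of_real (bessel_K_ratio a (p / (2 * (s * (1 - s))))) =
          of_real (1 / sqrt l) * exp (d * of_real (ln s)) * of_real (exp (l\<^sup>2 / p - 2 * l * cosh y)) * ext_amplitude p a b s"
        using s True unfolding exponent by (simp add: ext_amplitude_def exp_add mult_ac flip: exp_of_real)
      also have "exp (l\<^sup>2 / p - 2 * l * cosh y) = exp (l\<^sup>2 / p - 2 * l) * laplace_kernel l v"
        by (simp add: laplace_kernel_def y_def algebra_simps flip: exp_add)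
      also have "exp (d * of_real (ln s)) = exp (d * of_real (ln (p / l))) * exp (d * of_real y)"
        by (simp add: ln_s ring_distribs exp_add)
      finally show ?thesis
        by (simp add: scaleR_conv_of_real mult_ac)
    qed (simp add: f_def ext_amplitude_def)
    thus "(1 / sqrt l * (p / l * exp (1 / sqrt l * v))) *\<^sub>R f (p / l * exp (1 / sqrt l * v)) =
      of_real (exp (l\<^sup>2 / p - 2 * l) / sqrt l) * exp (d * of_real (ln (p / l))) *
       (laplace_kernel l v *\<^sub>R
         (exp (d * of_real (v / sqrt l)) * ext_amplitude p a b (p / l * exp (v / sqrt l))))"
      by (simp add: s_def y_def)
  qed
  also have "\<dots> = of_real (exp (l\<^sup>2 / p - 2 * l) / sqrt l) * exp (d * of_real (ln (p / l))) *
     (LINT v|lborel. laplace_kernel l v *\<^sub>R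
        (exp (d * of_real (v / sqrt l)) * ext_amplitude p a b (p / l * exp (v / sqrt l))))"
    by (rule integral_mult_right_zero)
  finally show ?thesis .
qed

text \<open>For l >= 1 the factor exp (d v / sqrt l) is at most exp (|Re d| |v|) in norm, which
  gives the domination. For fixed v the point (p/l) exp (v / sqrt l) tends to 0 from the right,
  where the amplitude has limit exp (- p).\<close>

lemma tendsto_ext_laplace_integral:
  assumes "p > 0"
  shows "((\<lambda>l. LINT v|lborel. laplace_kernel l v *\<^sub>R
            (exp (d * of_real (v / sqrt l)) * ext_amplitude p a b (p / l * exp (v / sqrt l)))) \<longlongrightarrow>
          of_real (sqrt pi * exp (- p))) at_top"
proof -
  obtain C where C: "C > 0" "\<And>s. norm (ext_amplitude p a b s) \<le> C"
    using ext_amplitude_bounded[OF assms] by metis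
  have "((\<lambda>l. LINT v|lborel. laplace_kernel l v *\<^sub>R
            (exp (d * of_real (v / sqrt l)) * ext_amplitude p a b (p / l * exp (v / sqrt l)))) \<longlongrightarrow>
          (LINT v|lborel. exp (- v\<^sup>2) *\<^sub>R of_real (exp (- p)))) at_top"
  proof (rule tendsto_integral_laplace_kernel)
    show "\<forall>\<^sub>F l in at_top. \<forall>v. norm (exp (d * of_real (v / sqrt l)) * ext_amplitude p a b (p / l * exp (v / sqrt l)))
            \<le> C * exp (\<bar>Re d\<bar> * \<bar>v\<bar>)"
      using eventually_ge_at_top[of 1]
    proof eventually_elim
      case (elim l)
      show ?case
      proof
        fix v :: real
        have "\<bar>Re d\<bar> * \<bar>v\<bar> / sqrt l \<le> \<bar>Re d\<bar> * \<bar>v\<bar> / 1"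
          using elim by (intro divide_left_mono) auto
        hence "\<bar>Re d * (v / sqrt l)\<bar> \<le> \<bar>Re d\<bar> * \<bar>v\<bar>"
          using elim by (simp add: abs_mult)
        hence "norm (exp (d * of_real (v / sqrt l))) \<le> exp (\<bar>Re d\<bar> * \<bar>v\<bar>)"
          using abs_le_D1 by fastforce
        hence "norm (exp (d * of_real (v / sqrt l))) * norm (ext_amplitude p a b (p / l * exp (v / sqrt l)))
                 \<le> exp (\<bar>Re d\<bar> * \<bar>v\<bar>) * C"
          using C by (intro mult_mono) auto
        thus "norm (exp (d * of_real (v / sqrt l)) * ext_amplitude p a b (p / l * exp (v / sqrt l)))
            \<le> C * exp (\<bar>Re d\<bar> * \<bar>v\<bar>)"
          by (simp only: norm_mult mult.commute)
      qed
    qed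
    show "((\<lambda>l. exp (d * of_real (v / sqrt l)) * ext_amplitude p a b (p / l * exp (v / sqrt l)))
             \<longlongrightarrow> of_real (exp (- p))) at_top" for v :: real
    proof -
      have v: "((\<lambda>l. v / sqrt l) \<longlongrightarrow> 0) at_top"
        by (intro real_tendsto_divide_at_top[OF tendsto_const] sqrt_at_top)
      have "((\<lambda>l. p / l) \<longlongrightarrow> 0) at_top"
        by (intro real_tendsto_divide_at_top[OF tendsto_const] filterlim_ident)
      hence "((\<lambda>l. p / l * exp (v / sqrt l)) \<longlongrightarrow> 0 * exp 0) at_top"
        by (intro tendsto_intros v)
      moreover have "\<forall>\<^sub>F l in at_top. p / l * exp (v / sqrt l) > 0"
        using eventually_gt_at_top[of 0]
        by eventually_elim (use assms in auto)
      ultimately have "filterlim (\<lambda>l. p / l * exp (v / sqrt l)) (at_right 0) at_top"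
        by (intro tendsto_imp_filterlim_at_right) auto
      hence "((\<lambda>l. ext_amplitude p a b (p / l * exp (v / sqrt l))) \<longlongrightarrow> of_real (exp (- p))) at_top"
        by (rule filterlim_compose[OF tendsto_ext_amplitude[OF assms]])
      hence "((\<lambda>l. exp (d * of_real (v / sqrt l)) * ext_amplitude p a b (p / l * exp (v / sqrt l)))
             \<longlongrightarrow> exp (d * of_real 0) * of_real (exp (- p))) at_top"
        by (intro tendsto_intros v)
      thus ?thesis by simp
    qed
  qed measurable
  also have "(LINT v|lborel. exp (- v\<^sup>2) *\<^sub>R complex_of_real (exp (- p))) = (LINT v|lborel. exp (- v\<^sup>2)) *\<^sub>R of_real (exp (- p))"
    using integrable_gaussian_exp_abs[of 0] by (intro integral_scaleR_left) auto
  also have "(LINT v|lborel. exp (- v\<^sup>2 :: real)) = 2 *\<^sub>R (sqrt pi / 2)"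
    by (intro has_bochner_integral_integral_eq has_bochner_integral_even_function[OF gaussian_moment_0]) simp
  finally show ?thesis
    by (simp add: scaleR_conv_of_real)
qed

section \<open>From the confluent function to the Whittaker function\<close>

lemma Beta_nonzero:
  fixes b d :: complex
  assumes "b \<notin> \<int>\<^sub>\<le>\<^sub>0" "d \<notin> \<int>\<^sub>\<le>\<^sub>0" "b + d \<notin> \<int>\<^sub>\<le>\<^sub>0"
  shows "Beta b d \<noteq> 0"
  \<comment> \<open>\<open>Gamma\<close> has the value 0 at its poles, so the numerator vanishes
    only there, and division by zero would make the quotient 0 at a pole of the denominator.\<close>
  using assms by (simp add: Beta_def Gamma_eq_zero_iff)

theorem theorem3:
  fixes p \<nu> :: real and \<kappa> \<mu> :: complex
  assumes "p > 0" and "\<nu> \<ge> 0"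
    and "\<forall>n::nat. n \<ge> 1 \<longrightarrow> 2 * \<mu> \<noteq> - of_nat n"
    and "\<mu> + \<kappa> + 1/2 \<notin> \<int>\<^sub>\<le>\<^sub>0" and "\<mu> - \<kappa> + 1/2 \<notin> \<int>\<^sub>\<le>\<^sub>0"
  shows "((\<lambda>x::real. ext_Whittaker_M (of_real p) \<nu> \<kappa> \<mu> (of_real x) /
             (of_real (sqrt pi) * of_real (exp (- p)) * of_real p powr ((\<mu> + \<kappa>) / 2)
                / Beta (\<mu> - \<kappa> + 1/2) (\<mu> + \<kappa> + 1/2)
              * of_real x powr ((\<mu> - \<kappa>) / 2) * of_real (exp (x / 2 - 2 * sqrt (p * x)))))
          \<longlongrightarrow> 1) at_top"
proof -
  define b where "b = \<mu> - \<kappa> + 1/2"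
  define d where "d = \<mu> + \<kappa> + 1/2"
  define S where "S l = (LINT v|lborel. laplace_kernel l v *\<^sub>R
      (exp (d * of_real (v / sqrt l)) * ext_amplitude p (\<nu> + 1/2) b (p / l * exp (v / sqrt l))))" for l
  have bd: "2 * \<mu> + 1 - b = d"
    by (simp add: b_def d_def)
  \<comment> \<open>This is b + d, the denominator argument of \<open>Beta\<close>; the shift by 1
    matches 2\<mu> = -1, -2, ... with the nonpositive integers.\<close>
  have "2 * \<mu> + 1 \<notin> \<int>\<^sub>\<le>\<^sub>0"
  proof
    assume "2 * \<mu> + 1 \<in> \<int>\<^sub>\<le>\<^sub>0"
    then obtain n where n: "2 * \<mu> + 1 = - of_nat n"
      by (auto elim: nonpos_Ints_cases')
    have "2 * \<mu> = (2 * \<mu> + 1) - 1"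
      by simp
    also have "\<dots> = - of_nat (Suc n)"
      unfolding n by simp
    finally have "2 * \<mu> = - of_nat (Suc n)" .
    thus False
      using assms(3) by (metis le_add1 plus_1_eq_Suc)
  qed
  hence Beta: "Beta b d \<noteq> 0"
    using assms(4,5) bd by (intro Beta_nonzero) (auto simp: b_def d_def algebra_simps)
  have "filterlim (\<lambda>x. sqrt (p * x)) at_top at_top"
    using assms(1) by real_asymp
  hence "((\<lambda>x. S (sqrt (p * x))) \<longlongrightarrow> of_real (sqrt pi * exp (- p))) at_top"
    unfolding S_def by (rule filterlim_compose[OF tendsto_ext_laplace_integral[OF assms(1)]])
  hence "((\<lambda>x. S (sqrt (p * x)) / of_real (sqrt pi * exp (- p))) \<longlongrightarrow>
          of_real (sqrt pi * exp (- p)) / of_real (sqrt pi * exp (- p))) at_top"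
    by (intro tendsto_intros) auto
  hence lim: "((\<lambda>x. S (sqrt (p * x)) / of_real (sqrt pi * exp (- p))) \<longlongrightarrow> 1) at_top"
    by simp
  \<comment> \<open>For x > 0 this is an exact identity: all powers and exponentials cancel, and
    only the normalised Laplace integral remains.\<close>
  have "\<forall>\<^sub>F x in at_top. S (sqrt (p * x)) / of_real (sqrt pi * exp (- p)) =
      ext_Whittaker_M (of_real p) \<nu> \<kappa> \<mu> (of_real x) /
             (of_real (sqrt pi) * of_real (exp (- p)) * of_real p powr ((\<mu> + \<kappa>) / 2)
                / Beta b d
              * of_real x powr ((\<mu> - \<kappa>) / 2) * of_real (exp (x / 2 - 2 * sqrt (p * x))))"
    using eventually_gt_at_top[of 0]
  proof eventually_elim
    case (elim x)
    define l where "l = sqrt (p * x)"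
    have l: "l > 0" and x: "x = l\<^sup>2 / p"
      using elim assms(1) by (simp_all add: l_def)
    have ln_l: "ln l = (ln p + ln x) / 2"
      using elim assms(1) by (simp add: l_def ln_sqrt ln_mult)
    have ln_pl: "ln (p / l) = (ln p - ln x) / 2"
      using l assms(1) by (simp add: ln_div ln_l field_simps)
    have sqrt_l: "1 / sqrt l = exp (- (ln p + ln x) / 4)"
    proof -
      have "exp (- (ln p + ln x) / 4) = exp (- ln (sqrt l))"
        using l by (simp add: ln_sqrt ln_l field_simps)
      thus ?thesis
        using l by (simp add: exp_minus inverse_eq_divide)
    qed
    \<comment> \<open>Every power becomes the exponential of a linear form in ln p and ln x, so the
      identity reduces to comparing exponents. \<open>E\<close> collects the factor exp (x - 2l) /
      sqrt l.\<close>
    define E where "E = x - 2 * l + - (ln p + ln x) / 4"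
    have "ext_Phi (of_real p) \<nu> b (2 * \<mu> + 1) (of_real x) =
        of_real (exp (x - 2 * l) / sqrt l) * exp (d * of_real (ln (p / l))) * S l / Beta b d"
      using ext_integral_eq_laplace[OF assms(1) l, of "\<nu> + 1/2" b d]
      unfolding ext_Phi_eq_integral[OF assms(1)] bd S_def x[symmetric] by simp
    also have "exp (x - 2 * l) / sqrt l = exp (x - 2 * l) * (1 / sqrt l)"
      by simp
    also have "\<dots> = exp E"
      unfolding sqrt_l E_def exp_add ..
    finally have "ext_Whittaker_M (of_real p) \<nu> \<kappa> \<mu> (of_real x) =
        exp ((\<mu> + 1/2) * of_real (ln x) + of_real (- x / 2) + of_real E +
             d * of_real ((ln p - ln x) / 2)) * S l / Beta b d"
      using elim
      by (simp only: ext_Whittaker_M_def b_def[symmetric] of_real_powr_eq_exp ln_pl exp_add mult_ac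
            times_divide_eq_right of_real_minus of_real_divide of_real_numeral minus_divide_left
          flip: exp_of_real)
    \<comment> \<open>The coefficient of ln x is \<mu> + 1/2 - 1/4 - d/2 and that of ln p is d/2 -
      1/4.\<close>
    also have "(\<mu> + 1/2) * of_real (ln x) + of_real (- x / 2) + of_real E +
             d * of_real ((ln p - ln x) / 2) =
        (\<mu> + \<kappa>) / 2 * of_real (ln p) + (\<mu> - \<kappa>) / 2 * of_real (ln x) + of_real (x / 2 - 2 * l)"
      by (simp add: d_def E_def field_simps)
    also have "exp \<dots> = of_real p powr ((\<mu> + \<kappa>) / 2) * of_real x powr ((\<mu> - \<kappa>) / 2) * of_real (exp (x / 2 - 2 * l))"
      using elim assms(1) by (simp only: of_real_powr_eq_exp exp_add exp_of_real)
    finally show ?case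
      using elim assms(1) Beta by (simp add: l_def)
  qed
  from Lim_transform_eventually[OF lim this] show ?thesis
    by (simp only: b_def d_def)
qed

end
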